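(* The class $\mathcal{X}$ of countable (including finite) Boolean algebras is adequate for LTP; that is, for every set of LTP-formulas $\Delta$ and every LTP-formula $\psi$: $\Delta\vDash\psi$ iff $\Delta\vDash_{\mathcal{X}}\psi$.
   Context: Boolean algebras $B$ are written with operations $0,1,-,+,\cdot$ (bottom, top, complement, join, meet); the one-element Boolean algebra is allowed. The powerset $\mathcal{P}(B)$ carries external operations $\bot=\emptyset$, $\neg X=B\setminus X$, $X\vee Y=X\cup Y$, $X\wedge Y=X\cap Y$, and internal operations $\dot\bot=\{0\}$, $\dot\neg X=\{-a\mid a\in X\}$, $X\mathbin{\dot\vee}Y=\{a+b\mid a\in X,b\in Y\}$, $X\mathbin{\dot\wedge}Y=\{a\cdot b\mid a\in X,b\in Y\}$. The formulas of LTP form the absolutely free algebra $\mathrm{Fm}$ generated by propositional variables $P_0,P_1,\dots$ (indexed by $\mathbb{N}$) using constants $\bot,\dot\bot$, unary $\neg,\dot\neg$, and binary $\vee,\wedge,\dot\vee,\dot\wedge$. Homomorphisms $H:\mathrm{Fm}\to\mathcal{P}(B)$ preserve all eight operations. For a class $\mathcal{X}$ of Boolean algebras, $\Delta\vDash_{\mathcal{X}}\psi$ iff for all $B\in\mathcal{X}$ and all homomorphisms $H:\mathrm{Fm}\to\mathcal{P}(B)$, $\bigcap_{\phi\in\Delta}H(\phi)\subseteq H(\psi)$ (the empty intersection being $B$). $\Delta\vDash\psi$ is the same condition with $B$ ranging over all Boolean algebras. *)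

theory Defs
  imports Main "HOL-Library.Countable_Set"
begin

record 'a bool_alg =
  carrier :: "'a set"
  zero :: 'a  (\<open>\<zero>\<index>\<close>)
  one :: 'a  (\<open>\<one>\<index>\<close>)
  compl :: "'a \<Rightarrow> 'a"  (\<open>\<sim>\<index> _\<close> [81] 80)
  join :: "'a \<Rightarrow> 'a \<Rightarrow> 'a"  (infixl \<open>\<oplus>\<index>\<close> 65)
  meet :: "'a \<Rightarrow> 'a \<Rightarrow> 'a"  (infixl \<open>\<otimes>\<index>\<close> 70)

text \<open>The axioms are those of the locale \<^locale>\<open>abstract_boolean_algebra\<close>, relativised to the
  carrier.  Since \<open>\<zero> \<noteq> \<one>\<close> is not required, the one-element algebra is included.\<close>

locale boolean_alg =
  fixes B :: "'a bool_alg" (structure)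
  assumes zero_closed: "\<zero> \<in> carrier B"
    and one_closed: "\<one> \<in> carrier B"
    and compl_closed: "a \<in> carrier B \<Longrightarrow> \<sim> a \<in> carrier B"
    and join_closed: "\<lbrakk>a \<in> carrier B; b \<in> carrier B\<rbrakk> \<Longrightarrow> a \<oplus> b \<in> carrier B"
    and meet_closed: "\<lbrakk>a \<in> carrier B; b \<in> carrier B\<rbrakk> \<Longrightarrow> a \<otimes> b \<in> carrier B"
    and join_assoc: "\<lbrakk>a \<in> carrier B; b \<in> carrier B; c \<in> carrier B\<rbrakk>
          \<Longrightarrow> (a \<oplus> b) \<oplus> c = a \<oplus> (b \<oplus> c)"
    and meet_assoc: "\<lbrakk>a \<in> carrier B; b \<in> carrier B; c \<in> carrier B\<rbrakk>
          \<Longrightarrow> (a \<otimes> b) \<otimes> c = a \<otimes> (b \<otimes> c)"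
    and join_commute: "\<lbrakk>a \<in> carrier B; b \<in> carrier B\<rbrakk> \<Longrightarrow> a \<oplus> b = b \<oplus> a"
    and meet_commute: "\<lbrakk>a \<in> carrier B; b \<in> carrier B\<rbrakk> \<Longrightarrow> a \<otimes> b = b \<otimes> a"
    and meet_join_distrib: "\<lbrakk>a \<in> carrier B; b \<in> carrier B; c \<in> carrier B\<rbrakk>
          \<Longrightarrow> a \<otimes> (b \<oplus> c) = (a \<otimes> b) \<oplus> (a \<otimes> c)"
    and join_meet_distrib: "\<lbrakk>a \<in> carrier B; b \<in> carrier B; c \<in> carrier B\<rbrakk>
          \<Longrightarrow> a \<oplus> (b \<otimes> c) = (a \<oplus> b) \<otimes> (a \<oplus> c)"
    and meet_one: "a \<in> carrier B \<Longrightarrow> a \<otimes> \<one> = a"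
    and join_zero: "a \<in> carrier B \<Longrightarrow> a \<oplus> \<zero> = a"
    and meet_compl: "a \<in> carrier B \<Longrightarrow> a \<otimes> \<sim> a = \<zero>"
    and join_compl: "a \<in> carrier B \<Longrightarrow> a \<oplus> \<sim> a = \<one>"

definition boolean_algs :: "'a bool_alg set" where
  "boolean_algs = {B. boolean_alg B}"

definition countable_boolean_algs :: "'a bool_alg set" where
  "countable_boolean_algs = {B. boolean_alg B \<and> countable (carrier B)}"

definition dot_bot :: "'a bool_alg \<Rightarrow> 'a set" where
  "dot_bot B = {\<zero>\<^bsub>B\<^esub>}"

definition dot_neg :: "'a bool_alg \<Rightarrow> 'a set \<Rightarrow> 'a set" where
  "dot_neg B X = {\<sim>\<^bsub>B\<^esub> a | a. a \<in> X}"

definition dot_or :: "'a bool_alg \<Rightarrow> 'a set \<Rightarrow> 'a set \<Rightarrow> 'a set" where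
  "dot_or B X Y = {a \<oplus>\<^bsub>B\<^esub> b | a b. a \<in> X \<and> b \<in> Y}"

definition dot_and :: "'a bool_alg \<Rightarrow> 'a set \<Rightarrow> 'a set \<Rightarrow> 'a set" where
  "dot_and B X Y = {a \<otimes>\<^bsub>B\<^esub> b | a b. a \<in> X \<and> b \<in> Y}"

datatype fm =
    Var nat
  | Bot
  | DBot
  | Neg fm
  | DNeg fm
  | Or fm fm
  | And fm fm
  | DOr fm fm
  | DAnd fm fm

text \<open>Homomorphisms from the formula algebra to the powerset of the carrier of \<open>B\<close>.\<close>

definition fm_hom :: "'a bool_alg \<Rightarrow> (fm \<Rightarrow> 'a set) \<Rightarrow> bool" where
  "fm_hom B H \<longleftrightarrow>
     (\<forall>\<phi>. H \<phi> \<subseteq> carrier B) \<and>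
     H Bot = {} \<and>
     H DBot = dot_bot B \<and>
     (\<forall>\<phi>. H (Neg \<phi>) = carrier B - H \<phi>) \<and>
     (\<forall>\<phi>. H (DNeg \<phi>) = dot_neg B (H \<phi>)) \<and>
     (\<forall>\<phi> \<psi>. H (Or \<phi> \<psi>) = H \<phi> \<union> H \<psi>) \<and>
     (\<forall>\<phi> \<psi>. H (And \<phi> \<psi>) = H \<phi> \<inter> H \<psi>) \<and>
     (\<forall>\<phi> \<psi>. H (DOr \<phi> \<psi>) = dot_or B (H \<phi>) (H \<psi>)) \<and>
     (\<forall>\<phi> \<psi>. H (DAnd \<phi> \<psi>) = dot_and B (H \<phi>) (H \<psi>))"

text \<open>Consequence over a class \<open>\<X>\<close> of Boolean algebras.  Intersecting with the carrier makes the
  intersection over the empty set of premises equal to the carrier.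

  HOL cannot quantify over types inside a formula, so a class of Boolean algebras is a set of
  algebras whose carriers are subsets of one type \<open>'a\<close>, and consequence over all Boolean algebras
  is \<open>entails (boolean_algs :: 'a bool_alg set)\<close> with \<open>'a\<close> arbitrary.  If \<open>'a\<close> is infinite,
  every countable Boolean algebra has an isomorphic copy with carrier in \<open>'a\<close>; and every
  Boolean algebra, on any type \<open>'b\<close>, has one in the infinite type \<open>'b + nat\<close>.\<close>

definition entails :: "'a bool_alg set \<Rightarrow> fm set \<Rightarrow> fm \<Rightarrow> bool" where
  "entails \<X> \<Delta> \<psi> \<longleftrightarrow>
     (\<forall>B\<in>\<X>. \<forall>H. fm_hom B H \<longrightarrow> carrier B \<inter> (\<Inter>\<phi>\<in>\<Delta>. H \<phi>) \<subseteq> H \<psi>)"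

end

theory Submission
  imports Defs
begin

text \<open>A downward Loewenheim--Skolem argument: a counterexample in a Boolean algebra \<open>B\<close> is an
  element \<open>a\<close> together with a homomorphism \<open>H\<close>.  Close \<open>{a}\<close> under the operations of \<open>B\<close> and
  under a choice of witnesses for membership in the sets that interpret the internal connectives.
  The result \<open>C\<close> is a countable subalgebra, and \<open>\<phi> \<mapsto> H \<phi> \<inter> C\<close> is a homomorphism into its
  powerset that still refutes the entailment at \<open>a\<close>.  A countable algebra is then moved to any
  infinite type along an injection.\<close>

section \<open>Countability of formulas and countable closures\<close>

instance fm :: countable
  by countable_datatype

text \<open>Iterating the one-step extension \<open>S\<close> through all natural numbers suffices,
  because \<open>G\<close> takes only two arguments. Letting \<open>G\<close> be set-valued allows
  constants, unary and binary operations and witness choices to be treated by one closure.\<close>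

lemma countable_closure:
  fixes G :: "'a \<Rightarrow> 'a \<Rightarrow> 'a set"
  assumes "countable X" "X \<subseteq> A"
    and cnt: "\<And>x y. countable (G x y)"
    and sub: "\<And>x y. \<lbrakk>x \<in> A; y \<in> A\<rbrakk> \<Longrightarrow> G x y \<subseteq> A"
  obtains C where "X \<subseteq> C" "C \<subseteq> A" "countable C" "\<And>x y. \<lbrakk>x \<in> C; y \<in> C\<rbrakk> \<Longrightarrow> G x y \<subseteq> C"
proof
  define S where "S = (\<lambda>Y. Y \<union> (\<Union>x\<in>Y. \<Union>y\<in>Y. G x y))"
  define T where "T = (\<lambda>n. (S ^^ n) X)"
  have T_Suc: "T (Suc n) = S (T n)" for n
    by (simp add: T_def)
  have T0: "T 0 = X"
    by (simp add: T_def)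
  have mono: "T m \<subseteq> T n" if "m \<le> n" for m n
    using that by (rule lift_Suc_mono_le[rotated]) (auto simp: T_Suc S_def)
  show "X \<subseteq> (\<Union>n. T n)"
    using T0 by blast
  have "T n \<subseteq> A" for n
  proof (induction n)
    case (Suc n)
    then show ?case
      unfolding T_Suc S_def using sub by blast
  qed (simp add: T0 \<open>X \<subseteq> A\<close>)
  then show "(\<Union>n. T n) \<subseteq> A"
    by blast
  have "countable (T n)" for n
    by (induction n) (auto simp: T0 T_Suc S_def \<open>countable X\<close> cnt)
  then show "countable (\<Union>n. T n)"
    by blast
  show "G x y \<subseteq> (\<Union>n. T n)" if xy: "x \<in> (\<Union>n. T n)" "y \<in> (\<Union>n. T n)" for x y
  proof -
    obtain m n where "x \<in> T m" "y \<in> T n"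
      using xy by blast
    \<comment> \<open>The stages increase, so both arguments meet at a common stage and
      \<open>G x y\<close> is added at the next one.\<close>
    then have "x \<in> T (max m n)" "y \<in> T (max m n)"
      using mono[of m "max m n"] mono[of n "max m n"] by auto
    then have "G x y \<subseteq> T (Suc (max m n))"
      by (auto simp: T_Suc S_def)
    then show ?thesis
      by blast
  qed
qed

section \<open>Countable subalgebras and restricted homomorphisms\<close>

lemma boolean_alg_subalgebra:
  assumes "boolean_alg B" "C \<subseteq> carrier B" "\<zero>\<^bsub>B\<^esub> \<in> C" "\<one>\<^bsub>B\<^esub> \<in> C"
    and "\<And>a. a \<in> C \<Longrightarrow> \<sim>\<^bsub>B\<^esub> a \<in> C"
    and "\<And>a b. \<lbrakk>a \<in> C; b \<in> C\<rbrakk> \<Longrightarrow> a \<oplus>\<^bsub>B\<^esub> b \<in> C"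
    and "\<And>a b. \<lbrakk>a \<in> C; b \<in> C\<rbrakk> \<Longrightarrow> a \<otimes>\<^bsub>B\<^esub> b \<in> C"
  shows "boolean_alg (B\<lparr>carrier := C\<rparr>)"
proof -
  interpret boolean_alg B by fact
  have C: "a \<in> carrier B" if "a \<in> C" for a
    using assms(2) that by blast
  show ?thesis
    by unfold_locales
      (simp_all add: assms(3-) C meet_one join_zero meet_compl join_compl,
       (rule join_assoc meet_assoc join_commute meet_commute meet_join_distrib join_meet_distrib;
        simp add: C)+)
qed

lemma fm_hom_closed:
  assumes "fm_hom B H" "x \<in> H \<phi>"
  shows "x \<in> carrier B"
  using assms by (auto simp: fm_hom_def)

text \<open>Only internal connectives assert the existence of other elements; external ones are
  decided at \<open>c\<close> itself. The implications make a suitable \<open>W\<close> exist for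
  every \<open>c\<close>, so that a total choice function can be taken later.\<close>

definition witnesses :: "'a bool_alg \<Rightarrow> (fm \<Rightarrow> 'a set) \<Rightarrow> 'a \<Rightarrow> fm \<Rightarrow> fm \<Rightarrow> 'a set \<Rightarrow> bool" where
  "witnesses B H c \<phi> \<chi> W \<longleftrightarrow> finite W \<and> W \<subseteq> carrier B \<and>
     (c \<in> H (DNeg \<phi>) \<longrightarrow> c \<in> dot_neg B (H \<phi> \<inter> W)) \<and>
     (c \<in> H (DOr \<phi> \<chi>) \<longrightarrow> c \<in> dot_or B (H \<phi> \<inter> W) (H \<chi> \<inter> W)) \<and>
     (c \<in> H (DAnd \<phi> \<chi>) \<longrightarrow> c \<in> dot_and B (H \<phi> \<inter> W) (H \<chi> \<inter> W))"

text \<open>At most two elements are needed for each connective, and the three sets found separately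
  can be united.\<close>

lemma fm_hom_witnesses:
  assumes H: "fm_hom B H"
  shows "\<exists>W. witnesses B H c \<phi> \<chi> W"
proof -
  note closed = fm_hom_closed[OF H]
  have 1: "\<exists>W. finite W \<and> W \<subseteq> carrier B \<and> (c \<in> H (DNeg \<phi>) \<longrightarrow> c \<in> dot_neg B (H \<phi> \<inter> W))"
  proof (cases "c \<in> H (DNeg \<phi>)")
    case True
    then obtain x where "x \<in> H \<phi>" "c = \<sim>\<^bsub>B\<^esub> x"
      using H by (auto simp: fm_hom_def dot_neg_def)
    then show ?thesis
      by (intro exI[of _ "{x}"]) (auto simp: dot_neg_def closed)
  qed auto
  have 2: "\<exists>W. finite W \<and> W \<subseteq> carrier B \<and>
    (c \<in> H (DOr \<phi> \<chi>) \<longrightarrow> c \<in> dot_or B (H \<phi> \<inter> W) (H \<chi> \<inter> W))"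
  proof (cases "c \<in> H (DOr \<phi> \<chi>)")
    case True
    then obtain x y where "x \<in> H \<phi>" "y \<in> H \<chi>" "c = x \<oplus>\<^bsub>B\<^esub> y"
      using H by (auto simp: fm_hom_def dot_or_def)
    then show ?thesis
      by (intro exI[of _ "{x, y}"]) (auto simp: dot_or_def closed)
  qed auto
  have 3: "\<exists>W. finite W \<and> W \<subseteq> carrier B \<and>
    (c \<in> H (DAnd \<phi> \<chi>) \<longrightarrow> c \<in> dot_and B (H \<phi> \<inter> W) (H \<chi> \<inter> W))"
  proof (cases "c \<in> H (DAnd \<phi> \<chi>)")
    case True
    then obtain x y where "x \<in> H \<phi>" "y \<in> H \<chi>" "c = x \<otimes>\<^bsub>B\<^esub> y"
      using H by (auto simp: fm_hom_def dot_and_def)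
    then show ?thesis
      by (intro exI[of _ "{x, y}"]) (auto simp: dot_and_def closed)
  qed auto
  obtain U where U: "finite U" "U \<subseteq> carrier B"
    "c \<in> H (DNeg \<phi>) \<longrightarrow> c \<in> dot_neg B (H \<phi> \<inter> U)"
    using 1 by (elim exE conjE)
  obtain V where V: "finite V" "V \<subseteq> carrier B"
    "c \<in> H (DOr \<phi> \<chi>) \<longrightarrow> c \<in> dot_or B (H \<phi> \<inter> V) (H \<chi> \<inter> V)"
    using 2 by (elim exE conjE)
  obtain W where W: "finite W" "W \<subseteq> carrier B"
    "c \<in> H (DAnd \<phi> \<chi>) \<longrightarrow> c \<in> dot_and B (H \<phi> \<inter> W) (H \<chi> \<inter> W)"
    using 3 by (elim exE conjE)
  \<comment> \<open>The internal operations are monotone in their set arguments, so passing to the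
    union of \<open>U\<close>, \<open>V\<close> and \<open>W\<close> loses no membership.\<close>
  have mono: "dot_neg B X \<subseteq> dot_neg B X'" "dot_or B X Y \<subseteq> dot_or B X' Y'"
    "dot_and B X Y \<subseteq> dot_and B X' Y'" if "X \<subseteq> X'" "Y \<subseteq> Y'" for X X' Y Y'
    using that unfolding dot_neg_def dot_or_def dot_and_def by blast+
  have sub: "H \<theta> \<inter> U \<subseteq> H \<theta> \<inter> (U \<union> V \<union> W)" "H \<theta> \<inter> V \<subseteq> H \<theta> \<inter> (U \<union> V \<union> W)"
    "H \<theta> \<inter> W \<subseteq> H \<theta> \<inter> (U \<union> V \<union> W)" for \<theta>
    by blast+
  have "witnesses B H c \<phi> \<chi> (U \<union> V \<union> W)"
    unfolding witnesses_def
    using U V W mono(1)[OF sub(1) sub(1)] mono(2)[OF sub(2) sub(2)] mono(3)[OF sub(3) sub(3)]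
    by (simp add: subset_iff)
  then show ?thesis ..
qed

text \<open>This plays the part of the Tarski-Vaught test. For each internal connective, closure of
  \<open>C\<close> gives the inclusion from right to left and the witness assumption gives the
  converse. External connectives commute with restriction to \<open>C\<close>.\<close>

lemma fm_hom_restrict:
  assumes H: "fm_hom B H" and "C \<subseteq> carrier B" "\<zero>\<^bsub>B\<^esub> \<in> C"
    and compl: "\<And>a. a \<in> C \<Longrightarrow> \<sim>\<^bsub>B\<^esub> a \<in> C"
    and join: "\<And>a b. \<lbrakk>a \<in> C; b \<in> C\<rbrakk> \<Longrightarrow> a \<oplus>\<^bsub>B\<^esub> b \<in> C"
    and meet: "\<And>a b. \<lbrakk>a \<in> C; b \<in> C\<rbrakk> \<Longrightarrow> a \<otimes>\<^bsub>B\<^esub> b \<in> C"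
    and wneg: "\<And>c \<phi>. \<lbrakk>c \<in> C; c \<in> H (DNeg \<phi>)\<rbrakk> \<Longrightarrow> c \<in> dot_neg B (H \<phi> \<inter> C)"
    and wor: "\<And>c \<phi> \<chi>. \<lbrakk>c \<in> C; c \<in> H (DOr \<phi> \<chi>)\<rbrakk> \<Longrightarrow> c \<in> dot_or B (H \<phi> \<inter> C) (H \<chi> \<inter> C)"
    and wand: "\<And>c \<phi> \<chi>. \<lbrakk>c \<in> C; c \<in> H (DAnd \<phi> \<chi>)\<rbrakk> \<Longrightarrow> c \<in> dot_and B (H \<phi> \<inter> C) (H \<chi> \<inter> C)"
  shows "fm_hom (B\<lparr>carrier := C\<rparr>) (\<lambda>\<phi>. H \<phi> \<inter> C)"
proof -
  have eqs: "H Bot = {}" "H DBot = dot_bot B" "\<And>\<phi>. H (Neg \<phi>) = carrier B - H \<phi>"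
    "\<And>\<phi>. H (DNeg \<phi>) = dot_neg B (H \<phi>)"
    "\<And>\<phi> \<chi>. H (Or \<phi> \<chi>) = H \<phi> \<union> H \<chi>" "\<And>\<phi> \<chi>. H (And \<phi> \<chi>) = H \<phi> \<inter> H \<chi>"
    "\<And>\<phi> \<chi>. H (DOr \<phi> \<chi>) = dot_or B (H \<phi>) (H \<chi>)"
    "\<And>\<phi> \<chi>. H (DAnd \<phi> \<chi>) = dot_and B (H \<phi>) (H \<chi>)"
    using H by (auto simp: fm_hom_def)
  have "H (DNeg \<phi>) \<inter> C = dot_neg B (H \<phi> \<inter> C)" for \<phi>
    using wneg[of _ \<phi>] compl unfolding eqs by (auto simp: dot_neg_def)
  moreover have "H (DOr \<phi> \<chi>) \<inter> C = dot_or B (H \<phi> \<inter> C) (H \<chi> \<inter> C)" for \<phi> \<chi>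
  proof
    show "H (DOr \<phi> \<chi>) \<inter> C \<subseteq> dot_or B (H \<phi> \<inter> C) (H \<chi> \<inter> C)"
      using wor by blast
    show "dot_or B (H \<phi> \<inter> C) (H \<chi> \<inter> C) \<subseteq> H (DOr \<phi> \<chi>) \<inter> C"
      using join unfolding eqs by (auto simp: dot_or_def)
  qed
  moreover have "H (DAnd \<phi> \<chi>) \<inter> C = dot_and B (H \<phi> \<inter> C) (H \<chi> \<inter> C)" for \<phi> \<chi>
  proof
    show "H (DAnd \<phi> \<chi>) \<inter> C \<subseteq> dot_and B (H \<phi> \<inter> C) (H \<chi> \<inter> C)"
      using wand by blast
    show "dot_and B (H \<phi> \<inter> C) (H \<chi> \<inter> C) \<subseteq> H (DAnd \<phi> \<chi>) \<inter> C"
      using meet unfolding eqs by (auto simp: dot_and_def)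
  qed
  \<comment> \<open>The internal operations do not read the \<open>carrier\<close> field.\<close>
  moreover have "dot_neg (B\<lparr>carrier := C\<rparr>) = dot_neg B" "dot_or (B\<lparr>carrier := C\<rparr>) = dot_or B"
    "dot_and (B\<lparr>carrier := C\<rparr>) = dot_and B"
    by (simp_all add: fun_eq_iff dot_neg_def dot_or_def dot_and_def)
  ultimately show ?thesis
    using assms(2,3) unfolding fm_hom_def by (auto simp: eqs(1-3,5,6) dot_bot_def)
qed

text \<open>No induction on formulas is needed: \<open>H\<close> is given on all formulas, and the
  closure provides witnesses for all of them at once.\<close>

lemma countable_elementary_subalgebra:
  assumes B: "boolean_alg B" and H: "fm_hom B H" and a: "a \<in> carrier B"
  obtains C where "a \<in> C" "countable C" "boolean_alg (B\<lparr>carrier := C\<rparr>)"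
    "fm_hom (B\<lparr>carrier := C\<rparr>) (\<lambda>\<phi>. H \<phi> \<inter> C)"
proof -
  interpret boolean_alg B by fact
  obtain W where "\<And>c \<phi> \<chi>. witnesses B H c \<phi> \<chi> (W c \<phi> \<chi>)"
    using fm_hom_witnesses[OF H] by metis
  then have finW: "\<And>c \<phi> \<chi>. finite (W c \<phi> \<chi>)"
    and W_sub: "\<And>c \<phi> \<chi>. W c \<phi> \<chi> \<subseteq> carrier B"
    and W_neg: "\<And>c \<phi> \<chi>. c \<in> H (DNeg \<phi>) \<Longrightarrow> c \<in> dot_neg B (H \<phi> \<inter> W c \<phi> \<chi>)"
    and W_or: "\<And>c \<phi> \<chi>. c \<in> H (DOr \<phi> \<chi>) \<Longrightarrow>
      c \<in> dot_or B (H \<phi> \<inter> W c \<phi> \<chi>) (H \<chi> \<inter> W c \<phi> \<chi>)"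
    and W_and: "\<And>c \<phi> \<chi>. c \<in> H (DAnd \<phi> \<chi>) \<Longrightarrow>
      c \<in> dot_and B (H \<phi> \<inter> W c \<phi> \<chi>) (H \<chi> \<inter> W c \<phi> \<chi>)"
    unfolding witnesses_def by simp_all
  \<comment> \<open>Each \<open>G x y\<close> is countable because there are countably many pairs of
    formulas and every \<open>W x \<phi> \<chi>\<close> is finite.\<close>
  define G where "G = (\<lambda>x y. {\<zero>\<^bsub>B\<^esub>, \<one>\<^bsub>B\<^esub>, \<sim>\<^bsub>B\<^esub> x, x \<oplus>\<^bsub>B\<^esub> y, x \<otimes>\<^bsub>B\<^esub> y} \<union> (\<Union>\<phi> \<chi>. W x \<phi> \<chi>))"
  have cnt: "countable (G x y)" for x y
    by (auto simp: G_def countable_finite finW)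
  have sub: "G x y \<subseteq> carrier B" if "x \<in> carrier B" "y \<in> carrier B" for x y
    using that W_sub by (auto simp: G_def zero_closed one_closed compl_closed join_closed meet_closed)
  obtain C where C: "{a} \<subseteq> C" "C \<subseteq> carrier B" "countable C"
    and closed: "\<And>x y. \<lbrakk>x \<in> C; y \<in> C\<rbrakk> \<Longrightarrow> G x y \<subseteq> C"
    by (rule countable_closure[of "{a}" "carrier B" G]) (simp_all add: a cnt sub)
  have zero: "\<zero>\<^bsub>B\<^esub> \<in> C" and one: "\<one>\<^bsub>B\<^esub> \<in> C"
    using closed[of a a] C(1) by (auto simp: G_def)
  have compl: "\<sim>\<^bsub>B\<^esub> x \<in> C" if "x \<in> C" for x
    using closed[of x x] that by (auto simp: G_def)
  have ops: "x \<oplus>\<^bsub>B\<^esub> y \<in> C" "x \<otimes>\<^bsub>B\<^esub> y \<in> C" if "x \<in> C" "y \<in> C" for x y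
    using closed[of x y] that by (auto simp: G_def)
  have WC: "W x \<phi> \<chi> \<subseteq> C" if "x \<in> C" for x \<phi> \<chi>
    using closed[of x x] that by (auto simp: G_def)
  have "fm_hom (B\<lparr>carrier := C\<rparr>) (\<lambda>\<phi>. H \<phi> \<inter> C)"
  proof (rule fm_hom_restrict[OF H C(2) zero compl ops])
    show "c \<in> dot_neg B (H \<phi> \<inter> C)" if "c \<in> C" "c \<in> H (DNeg \<phi>)" for c \<phi>
      \<comment> \<open>\<open>Bot\<close> is an arbitrary second index: the clause for
        \<open>DNeg\<close> concerns \<open>\<phi>\<close> alone.\<close>
      using W_neg[OF that(2), of Bot] WC[OF that(1), of \<phi> Bot] by (auto simp: dot_neg_def)
    show "c \<in> dot_or B (H \<phi> \<inter> C) (H \<chi> \<inter> C)" if "c \<in> C" "c \<in> H (DOr \<phi> \<chi>)" for c \<phi> \<chi>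
      using W_or[OF that(2)] WC[OF that(1), of \<phi> \<chi>] unfolding dot_or_def by blast
    show "c \<in> dot_and B (H \<phi> \<inter> C) (H \<chi> \<inter> C)" if "c \<in> C" "c \<in> H (DAnd \<phi> \<chi>)" for c \<phi> \<chi>
      using W_and[OF that(2)] WC[OF that(1), of \<phi> \<chi>] unfolding dot_and_def by blast
  qed
  moreover have "boolean_alg (B\<lparr>carrier := C\<rparr>)"
    using boolean_alg_subalgebra[OF B C(2) zero one compl ops] .
  ultimately show thesis
    using that C by blast
qed

text \<open>The countable subalgebra stays in the type \<open>'a\<close>, so both sides can use the
  same type. One direction is inclusion of classes; for the other, an element of all premises is
  kept in the subalgebra.\<close>

lemma entails_boolean_algs_iff_countable:
  "entails (boolean_algs :: 'a bool_alg set) \<Delta> \<psi> \<longleftrightarrow>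
   entails (countable_boolean_algs :: 'a bool_alg set) \<Delta> \<psi>"
proof
  assume countable: "entails (countable_boolean_algs :: 'a bool_alg set) \<Delta> \<psi>"
  show "entails (boolean_algs :: 'a bool_alg set) \<Delta> \<psi>"
    unfolding entails_def
  proof (intro ballI allI impI subsetI)
    fix B :: "'a bool_alg" and H a
    assume B: "B \<in> boolean_algs" and H: "fm_hom B H"
      and a: "a \<in> carrier B \<inter> (\<Inter>\<phi>\<in>\<Delta>. H \<phi>)"
    then obtain C where C: "a \<in> C" "countable C" "boolean_alg (B\<lparr>carrier := C\<rparr>)"
      "fm_hom (B\<lparr>carrier := C\<rparr>) (\<lambda>\<phi>. H \<phi> \<inter> C)"
      using countable_elementary_subalgebra[of B H a] by (auto simp: boolean_algs_def)
    then have "B\<lparr>carrier := C\<rparr> \<in> countable_boolean_algs"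
      by (simp add: countable_boolean_algs_def)
    then have "C \<inter> (\<Inter>\<phi>\<in>\<Delta>. H \<phi> \<inter> C) \<subseteq> H \<psi> \<inter> C"
      using countable C(4) unfolding entails_def by fastforce
    then show "a \<in> H \<psi>"
      using a C(1) by blast
  qed
qed (auto simp: entails_def boolean_algs_def countable_boolean_algs_def)

section \<open>Transport along an injection\<close>

definition image_alg :: "('a \<Rightarrow> 'b) \<Rightarrow> 'a bool_alg \<Rightarrow> 'b bool_alg" where
  "image_alg f B = (let g = inv_into (carrier B) f in
     \<lparr>carrier = f ` carrier B, zero = f \<zero>\<^bsub>B\<^esub>, one = f \<one>\<^bsub>B\<^esub>,
      compl = (\<lambda>x. f (\<sim>\<^bsub>B\<^esub> g x)),
      join = (\<lambda>x y. f (g x \<oplus>\<^bsub>B\<^esub> g y)),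
      meet = (\<lambda>x y. f (g x \<otimes>\<^bsub>B\<^esub> g y))\<rparr>)"

text \<open>The inverse used in \<open>image_alg\<close> is meaningful only on the image of the
  carrier. These equations, which say that \<open>f\<close> is a homomorphism there, spare later
  proofs from unfolding it.\<close>

lemma image_alg_simps:
  "carrier (image_alg f B) = f ` carrier B"
  "\<zero>\<^bsub>image_alg f B\<^esub> = f \<zero>\<^bsub>B\<^esub>"
  "\<one>\<^bsub>image_alg f B\<^esub> = f \<one>\<^bsub>B\<^esub>"
  "\<lbrakk>inj_on f (carrier B); a \<in> carrier B\<rbrakk> \<Longrightarrow> \<sim>\<^bsub>image_alg f B\<^esub> (f a) = f (\<sim>\<^bsub>B\<^esub> a)"
  "\<lbrakk>inj_on f (carrier B); a \<in> carrier B; b \<in> carrier B\<rbrakk>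
    \<Longrightarrow> f a \<oplus>\<^bsub>image_alg f B\<^esub> f b = f (a \<oplus>\<^bsub>B\<^esub> b)"
  "\<lbrakk>inj_on f (carrier B); a \<in> carrier B; b \<in> carrier B\<rbrakk>
    \<Longrightarrow> f a \<otimes>\<^bsub>image_alg f B\<^esub> f b = f (a \<otimes>\<^bsub>B\<^esub> b)"
  by (simp_all add: image_alg_def Let_def)

lemma boolean_alg_image_alg:
  assumes "boolean_alg B" and inj: "inj_on f (carrier B)"
  shows "boolean_alg (image_alg f B)"
proof -
  interpret boolean_alg B by fact
  note closed = zero_closed one_closed compl_closed join_closed meet_closed
  show ?thesis
    by unfold_locales
      (auto simp: image_alg_simps inj closed meet_one join_zero meet_compl join_compl
        intro!: arg_cong[of _ _ f] join_assoc meet_assoc join_commute meet_commute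
        meet_join_distrib join_meet_distrib)
qed

text \<open>Injectivity lets images commute with difference and intersection; the internal
  operations are preserved because \<open>f\<close> is a homomorphism onto
  \<open>image_alg f B\<close>.\<close>

lemma fm_hom_image_alg:
  assumes H: "fm_hom B H" and inj: "inj_on f (carrier B)"
  shows "fm_hom (image_alg f B) (\<lambda>\<phi>. f ` H \<phi>)"
proof -
  note closed = fm_hom_closed[OF H]
  have sub: "H \<phi> \<subseteq> carrier B" for \<phi>
    using closed by blast
  have eqs: "H Bot = {}" "H DBot = dot_bot B" "\<And>\<phi>. H (Neg \<phi>) = carrier B - H \<phi>"
    "\<And>\<phi>. H (DNeg \<phi>) = dot_neg B (H \<phi>)"
    "\<And>\<phi> \<chi>. H (Or \<phi> \<chi>) = H \<phi> \<union> H \<chi>" "\<And>\<phi> \<chi>. H (And \<phi> \<chi>) = H \<phi> \<inter> H \<chi>"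
    "\<And>\<phi> \<chi>. H (DOr \<phi> \<chi>) = dot_or B (H \<phi>) (H \<chi>)"
    "\<And>\<phi> \<chi>. H (DAnd \<phi> \<chi>) = dot_and B (H \<phi>) (H \<chi>)"
    using H by (auto simp: fm_hom_def)
  have "f ` dot_bot B = dot_bot (image_alg f B)"
    by (simp add: dot_bot_def image_alg_simps)
  moreover have "f ` (carrier B - H \<phi>) = carrier (image_alg f B) - f ` H \<phi>" for \<phi>
    using inj_on_image_set_diff[OF inj] sub by (simp add: image_alg_simps)
  moreover have "f ` dot_neg B (H \<phi>) = dot_neg (image_alg f B) (f ` H \<phi>)" for \<phi>
  proof -
    have "f ` dot_neg B (H \<phi>) = (\<lambda>a. f (\<sim>\<^bsub>B\<^esub> a)) ` H \<phi>"
      by (auto simp: dot_neg_def)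
    also have "\<dots> = (\<lambda>a. \<sim>\<^bsub>image_alg f B\<^esub> (f a)) ` H \<phi>"
      by (intro image_cong refl) (simp add: image_alg_simps inj closed)
    also have "\<dots> = dot_neg (image_alg f B) (f ` H \<phi>)"
      by (auto simp: dot_neg_def)
    finally show ?thesis .
  qed
  moreover have "f ` (H \<phi> \<inter> H \<chi>) = f ` H \<phi> \<inter> f ` H \<chi>" for \<phi> \<chi>
    using inj_on_image_Int[OF inj sub sub] .
  moreover have "f ` dot_or B (H \<phi>) (H \<chi>) = dot_or (image_alg f B) (f ` H \<phi>) (f ` H \<chi>)" for \<phi> \<chi>
  proof -
    \<comment> \<open>Written as an image of a product, the set can be rewritten pointwise by the
      homomorphism equation.\<close>
    have "f ` dot_or B (H \<phi>) (H \<chi>) = (\<lambda>(a, b). f (a \<oplus>\<^bsub>B\<^esub> b)) ` (H \<phi> \<times> H \<chi>)"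
      by (force simp: dot_or_def)
    also have "\<dots> = (\<lambda>(a, b). f a \<oplus>\<^bsub>image_alg f B\<^esub> f b) ` (H \<phi> \<times> H \<chi>)"
      by (intro image_cong refl) (auto simp: image_alg_simps inj closed)
    also have "\<dots> = dot_or (image_alg f B) (f ` H \<phi>) (f ` H \<chi>)"
      by (force simp: dot_or_def)
    finally show ?thesis .
  qed
  moreover have "f ` dot_and B (H \<phi>) (H \<chi>) = dot_and (image_alg f B) (f ` H \<phi>) (f ` H \<chi>)" for \<phi> \<chi>
  proof -
    have "f ` dot_and B (H \<phi>) (H \<chi>) = (\<lambda>(a, b). f (a \<otimes>\<^bsub>B\<^esub> b)) ` (H \<phi> \<times> H \<chi>)"
      by (force simp: dot_and_def)
    also have "\<dots> = (\<lambda>(a, b). f a \<otimes>\<^bsub>image_alg f B\<^esub> f b) ` (H \<phi> \<times> H \<chi>)"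
      by (intro image_cong refl) (auto simp: image_alg_simps inj closed)
    also have "\<dots> = dot_and (image_alg f B) (f ` H \<phi>) (f ` H \<chi>)"
      by (force simp: dot_and_def)
    finally show ?thesis .
  qed
  ultimately show ?thesis
    unfolding fm_hom_def eqs by (simp add: image_alg_simps image_Un image_mono sub)
qed

text \<open>Every countable algebra over \<open>'b\<close> has a copy over the infinite type
  \<open>'a\<close>; the entailment is applied to the copy and pulled back by injectivity.\<close>

lemma entails_countable_transfer:
  assumes inf: "infinite (UNIV :: 'a set)"
    and ent: "entails (countable_boolean_algs :: 'a bool_alg set) \<Delta> \<psi>"
  shows "entails (countable_boolean_algs :: 'b bool_alg set) \<Delta> \<psi>"
  unfolding entails_def
proof (intro ballI allI impI subsetI)
  fix B :: "'b bool_alg" and H b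
  assume "B \<in> countable_boolean_algs" and H: "fm_hom B H"
    and b: "b \<in> carrier B \<inter> (\<Inter>\<phi>\<in>\<Delta>. H \<phi>)"
  then have B: "boolean_alg B" "countable (carrier B)"
    by (simp_all add: countable_boolean_algs_def)
  obtain e :: "nat \<Rightarrow> 'a" where e: "inj e"
    using infinite_countable_subset[OF inf] by blast
  \<comment> \<open>The carrier is numbered by naturals, which are then embedded into
    \<open>'a\<close>; injectivity is claimed only on the carrier.\<close>
  define f where "f = e \<circ> to_nat_on (carrier B)"
  have inj: "inj_on f (carrier B)"
    unfolding f_def using B(2) e by (intro comp_inj_on inj_on_to_nat_on) (auto intro: inj_on_subset)
  have "image_alg f B \<in> countable_boolean_algs"
    using boolean_alg_image_alg[OF B(1) inj] B(2)
    by (simp add: countable_boolean_algs_def image_alg_simps)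
  then have "f ` carrier B \<inter> (\<Inter>\<phi>\<in>\<Delta>. f ` H \<phi>) \<subseteq> f ` H \<psi>"
    using ent fm_hom_image_alg[OF H inj] unfolding entails_def by (fastforce simp: image_alg_simps)
  then have "f b \<in> f ` H \<psi>"
    using b by blast
  then show "b \<in> H \<psi>"
    using inj b fm_hom_closed[OF H] by (auto dest: inj_onD)
qed

text \<open>Uncountable algebras are first eliminated within \<open>'u\<close>. Each implication
  between the countable classes then uses that the type of its premise is infinite.\<close>

theorem theorem3p12:
  fixes \<Delta> :: "fm set" and \<psi> :: fm
  assumes "infinite (UNIV :: 'u set)" and "infinite (UNIV :: 'v set)"
  shows "entails (boolean_algs :: 'u bool_alg set) \<Delta> \<psi>
     \<longleftrightarrow> entails (countable_boolean_algs :: 'v bool_alg set) \<Delta> \<psi>"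
  using entails_countable_transfer[OF assms(1)] entails_countable_transfer[OF assms(2)]
  unfolding entails_boolean_algs_iff_countable by blast

end
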